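(* For every $\mathbf k\in(\mathbb N\cup\{\infty\})^\ell$, \[\mathcal I\mathcal O^{\mathbf k}=\langle\chi_{\mathbf n}\mid\mathbf 0<\mathbf n\le\mathbf k\rangle=\langle\chi_{\mathbf n}\mid\mathbf 0<\mathbf n\le\mathbf k,\ |\mathbf n|\text{ even}\rangle,\] where $\langle\cdot\rangle$ denotes the two-sided ideal of $\mathrm{NSym}^{(\ell)}$ generated.
   Context: Fix $\ell\ge1$; $|\mathbf n|=\sum n_i$, coordinatewise order on $(\mathbb N\cup\{\infty\})^\ell$; vector compositions are sequences of nonzero elements of $\mathbb N^\ell$. $\mathrm{QSym}^{(\ell)}$ is the $\mathbb Q$-span of $M_{\mathbf I}=\sum_{j_1<\dots<j_m}\mathbf x_{j_1}^{\mathbf i_1}\cdots\mathbf x_{j_m}^{\mathbf i_m}$ in commuting variables $x_j^{(i)}$ ($\mathbf x_j^{\mathbf n}=\prod_i(x_j^{(i)})^{n_i}$), a graded Hopf algebra with product of power series and deconcatenation coproduct. $\zeta_{\mathcal Q}(M_{\mathbf I})=1$ if $\mathbf I$ has length $\le1$, else $0$; $\bar\zeta_{\mathcal Q}(h)=(-1)^{|\mathbf n|}\zeta_{\mathcal Q}(h)$ for $h$ of degree $\mathbf n$; $\zeta_{\mathcal Q}^{-1}$ is the convolution inverse. $\mathrm{NSym}^{(\ell)}$ is the graded dual, with basis $S^{\mathbf I}$ dual to $M_{\mathbf I}$ (and $S^{\mathbf I}S^{\mathbf J}=S^{\mathbf I\mathbf J}$); a subscript $\mathbf n$ on a functional denotes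 its restriction to degree $\mathbf n$, an element of $\mathrm{NSym}^{(\ell)}$. $\mathcal I\mathcal O^{\mathbf k}$ is the ideal generated by $(\bar\zeta_{\mathcal Q})_{\mathbf n}-(\zeta_{\mathcal Q}^{-1})_{\mathbf n}$ for $\mathbf n\le\mathbf k$. The Euler character is the convolution $\chi=\bar\zeta_{\mathcal Q}\zeta_{\mathcal Q}$, so that $\chi_{\mathbf n}=\sum_{\mathbf j\le\mathbf n}(-1)^{|\mathbf j|}S^{(\mathbf j,\mathbf n-\mathbf j)}$, where zero columns are omitted from the index. *)

theory Defs
  imports
    "HOL-Library.Function_Algebras"
    "HOL-Library.Poly_Mapping"
    "HOL-Library.Extended_Nat"
    "HOL-Algebra.Ideal"
begin

text \<open>
  The finite type \<open>'l\<close> indexes the \<open>\<ell> = CARD('l) \<ge> 1\<close> coordinates, so a vector in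
  \<open>\<nat>\<^sup>\<ell>\<close> is a function \<open>'l \<Rightarrow> nat\<close> with pointwise zero, addition and order.
  A monomial in the variables \<open>x\<^sub>j\<^sup>(\<^sup>i\<^sup>)\<close> is given by the finitely supported map sending \<open>j\<close> to
  its vector of exponents; the monomial \<open>\<^bold>x\<^sub>j\<^sup>n\<close> is \<open>Poly_Mapping.single j n\<close>,
  and products of monomials are sums of such maps.
\<close>

type_synonym 'l monomial = "nat \<Rightarrow>\<^sub>0 ('l \<Rightarrow> nat)"
type_synonym 'l series = "'l monomial \<Rightarrow> rat"
type_synonym 'l functional = "'l series \<Rightarrow> rat"

definition vsize :: "('l::finite \<Rightarrow> nat) \<Rightarrow> nat" where
  "vsize n = (\<Sum>i\<in>UNIV. n i)"

definition vcomp :: "('l::finite \<Rightarrow> nat) list \<Rightarrow> bool" where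
  "vcomp I \<longleftrightarrow> 0 \<notin> set I"

definition monom_at :: "nat list \<Rightarrow> ('l::finite \<Rightarrow> nat) list \<Rightarrow> 'l monomial" where
  "monom_at js I = sum_list (map2 Poly_Mapping.single js I)"

text \<open>The coefficient of a monomial \<open>m\<close> in the formal sum \<open>M\<^sub>I\<close> is the number of summands
  equal to \<open>m\<close>.\<close>

definition MQ :: "('l::finite \<Rightarrow> nat) list \<Rightarrow> 'l series" where
  "MQ I = (\<lambda>m. of_nat (card {js. length js = length I \<and> sorted_wrt (<) js \<and> m = monom_at js I}))"

definition sscale :: "rat \<Rightarrow> ('m \<Rightarrow> rat) \<Rightarrow> 'm \<Rightarrow> rat" where
  "sscale c f = (\<lambda>m. c * f m)"

global_interpretation ser: vector_space "sscale :: rat \<Rightarrow> ('m \<Rightarrow> rat) \<Rightarrow> 'm \<Rightarrow> rat"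
  by unfold_locales (auto simp: sscale_def fun_eq_iff algebra_simps)

definition QSym :: "'l::finite series set" where
  "QSym = ser.span {MQ I |I. vcomp I}"

definition QSym_deg :: "('l::finite \<Rightarrow> nat) \<Rightarrow> 'l series set" where
  "QSym_deg n = ser.span {MQ I |I. vcomp I \<and> sum_list I = n}"

text \<open>Linear functionals on \<open>QSym\<close> are represented by functions vanishing outside \<open>QSym\<close>, so
  that equality of functionals is equality of functions.\<close>

definition QSym_dual :: "'l::finite functional set" where
  "QSym_dual = {\<phi>. (\<forall>f\<in>QSym. \<forall>g\<in>QSym. \<phi> (f + g) = \<phi> f + \<phi> g)
                  \<and> (\<forall>c. \<forall>f\<in>QSym. \<phi> (sscale c f) = c * \<phi> f)
                  \<and> (\<forall>f. f \<notin> QSym \<longrightarrow> \<phi> f = 0)}"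

definition on_basis :: "(('l::finite \<Rightarrow> nat) list \<Rightarrow> rat) \<Rightarrow> 'l functional" where
  "on_basis g = (THE \<phi>. \<phi> \<in> QSym_dual \<and> (\<forall>I. vcomp I \<longrightarrow> \<phi> (MQ I) = g I))"

definition on_degrees :: "(('l::finite \<Rightarrow> nat) \<Rightarrow> 'l functional) \<Rightarrow> 'l functional" where
  "on_degrees F = (THE \<phi>. \<phi> \<in> QSym_dual \<and> (\<forall>n. \<forall>h\<in>QSym_deg n. \<phi> h = F n h))"

text \<open>The convolution product \<open>(\<phi> \<otimes> \<psi>) \<circ> \<Delta>\<close> for the deconcatenation coproduct
  \<open>\<Delta> M\<^sub>I = \<Sum> M\<^sub>J \<otimes> M\<^sub>K\<close>, summed over \<open>I = J @ K\<close>.\<close>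

definition conv :: "'l::finite functional \<Rightarrow> 'l functional \<Rightarrow> 'l functional" where
  "conv \<phi> \<psi> = on_basis (\<lambda>I. \<Sum>r\<le>length I. \<phi> (MQ (take r I)) * \<psi> (MQ (drop r I)))"

definition counit :: "'l::finite functional" where
  "counit = on_basis (\<lambda>I. if I = [] then 1 else 0)"

definition Dual_alg :: "'l::finite functional ring" where
  "Dual_alg = \<lparr>carrier = QSym_dual, mult = conv, one = counit, zero = 0, add = (+)\<rparr>"

text \<open>The graded dual of \<open>QSym\<close>: all homogeneous components are finite-dimensional, so it
  consists of the functionals that vanish on all but finitely many of them.\<close>

definition NSym :: "'l::finite functional ring" where
  "NSym = Dual_alg\<lparr>carrier := {\<phi>\<in>QSym_dual. finite {n. \<exists>h\<in>QSym_deg n. \<phi> h \<noteq> 0}}\<rparr>"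

definition deg_part :: "'l::finite functional \<Rightarrow> ('l \<Rightarrow> nat) \<Rightarrow> 'l functional" where
  "deg_part \<phi> n = on_degrees (\<lambda>m h. if m = n then \<phi> h else 0)"

definition zetaQ :: "'l::finite functional" where
  "zetaQ = on_basis (\<lambda>I. if length I \<le> 1 then 1 else 0)"

definition zetaQ_bar :: "'l::finite functional" where
  "zetaQ_bar = on_degrees (\<lambda>n h. (-1) ^ vsize n * zetaQ h)"

definition zetaQ_inv :: "'l::finite functional" where
  "zetaQ_inv = inv\<^bsub>Dual_alg\<^esub> zetaQ"

definition euler_char :: "'l::finite functional" where
  "euler_char = conv zetaQ_bar zetaQ"

definition IO_ideal :: "('l::finite \<Rightarrow> enat) \<Rightarrow> 'l functional set" where
  "IO_ideal k = Idl\<^bsub>NSym\<^esub> {deg_part zetaQ_bar n - deg_part zetaQ_inv n |n. enat \<circ> n \<le> k}"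


text \<open>The unique-existence facts below show that \<open>on_basis\<close>, and \<open>on_degrees\<close> in both of its
  uses, denote the intended functionals.\<close>

lemma lookup_monom_at_notin:
  "length js = length I \<Longrightarrow> j \<notin> set js \<Longrightarrow> Poly_Mapping.lookup (monom_at js I) j = 0"
  by (induction js I rule: list_induct2) (auto simp: monom_at_def lookup_add lookup_single when_def)

lemma lookup_monom_at:
  "length js = length I \<Longrightarrow> distinct js \<Longrightarrow> map (Poly_Mapping.lookup (monom_at js I)) js = I"
proof (induction js I rule: list_induct2)
  case (Cons j js i I)
  have eq: "monom_at (j # js) (i # I) = Poly_Mapping.single j i + monom_at js I"
    by (simp add: monom_at_def)
  have "map (Poly_Mapping.lookup (monom_at (j # js) (i # I))) js = map (Poly_Mapping.lookup (monom_at js I)) js"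
    using Cons.prems by (auto simp: eq lookup_add lookup_single when_def)
  moreover have "Poly_Mapping.lookup (monom_at (j # js) (i # I)) j = i"
    using Cons by (simp add: eq lookup_add lookup_monom_at_notin)
  ultimately show ?case using Cons.IH Cons.prems by (metis list.simps(9) distinct.simps(2))
qed simp

lemma keys_monom_at:
  assumes "length js = length I" "distinct js" "vcomp I"
  shows "Poly_Mapping.keys (monom_at js I) = set js"
proof -
  have "Poly_Mapping.lookup (monom_at js I) j \<noteq> 0" if "j \<in> set js" for j
  proof -
    have "Poly_Mapping.lookup (monom_at js I) j \<in> set (map (Poly_Mapping.lookup (monom_at js I)) js)" using that by simp
    thus ?thesis using assms by (metis lookup_monom_at vcomp_def)
  qed
  thus ?thesis using lookup_monom_at_notin[OF assms(1)] by (auto simp: in_keys_iff)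
qed

lemma monom_at_inj:
  assumes "length js = length I" "sorted_wrt (<) js" "vcomp I"
    and "length js' = length J" "sorted_wrt (<) js'" "vcomp J"
    and eq: "monom_at js I = monom_at js' J"
  shows "js = js' \<and> I = J"
proof -
  have d: "distinct js" "distinct js'"
    using assms(2,5) by (auto simp: strict_sorted_iff)
  have "set js = set js'"
    using keys_monom_at[OF assms(1) d(1) assms(3)] keys_monom_at[OF assms(4) d(2) assms(6)] eq
    by simp
  hence "js = js'" using assms(2,5) by (simp add: strict_sorted_equal)
  thus ?thesis using lookup_monom_at[OF assms(1) d(1)] lookup_monom_at[OF assms(4) d(2)] eq by metis
qed

lemma MQ_leading:
  assumes "vcomp I" "vcomp J"
  shows "MQ J (monom_at [0..<length I] I) = (if I = J then 1 else 0)"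
proof -
  have "{js. length js = length J \<and> sorted_wrt (<) js \<and>
          monom_at [0..<length I] I = monom_at js J} = (if I = J then {[0..<length I]} else {})"
    using monom_at_inj[of "[0..<length I]" I _ J] assms by auto
  thus ?thesis by (simp add: MQ_def)
qed

lemma inj_on_MQ: "inj_on MQ {I. vcomp I}"
proof (rule inj_onI)
  fix I J :: "('a \<Rightarrow> nat) list"
  assume "I \<in> {I. vcomp I}" "J \<in> {I. vcomp I}" "MQ I = MQ J"
  thus "I = J" using MQ_leading[of I I] MQ_leading[of I J] by (simp split: if_splits)
qed

lemma independent_MQ: "ser.independent {MQ I |I. vcomp I}"
  unfolding ser.independent_explicit_module
proof (intro allI impI)
  fix t u v
  assume t: "finite t" "t \<subseteq> {MQ I |I. vcomp I}" "(\<Sum>v\<in>t. sscale (u v) v) = 0" "v \<in> t"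
  then obtain I where I: "vcomp I" "v = MQ I" by auto
  let ?m = "monom_at [0..<length I] I"
  have ev: "(\<Sum>v\<in>t. sscale (u v) v) m = (\<Sum>v\<in>t. u v * v m)" for m
    using t(1) by (induction t rule: finite_induct) (auto simp: sscale_def)
  have lead: "w ?m = (if w = v then 1 else 0)" if "w \<in> t" for w
  proof -
    from that t(2) obtain J where "vcomp J" "w = MQ J" by auto
    thus ?thesis using I MQ_leading[of I J] inj_onD[OF inj_on_MQ, of J I] by auto
  qed
  have "(\<Sum>w\<in>t. u w * w ?m) = (\<Sum>w\<in>t. if w = v then u w else 0)"
  proof (rule sum.cong)
    fix w assume "w \<in> t"
    thus "u w * w ?m = (if w = v then u w else 0)" by (subst lead) auto
  qed simp
  also have "\<dots> = u v" using t by simp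
  finally show "u v = 0" using ev[of ?m] t(3) by simp
qed

lemma QSym_dual_span:
  assumes "\<phi> \<in> QSym_dual" "\<psi> \<in> QSym_dual" "S \<subseteq> {MQ I |I. vcomp I}" "f \<in> ser.span S"
    and "\<And>x. x \<in> S \<Longrightarrow> \<psi> x = c * \<phi> x"
  shows "f \<in> QSym \<and> \<psi> f = c * \<phi> f"
proof (rule ser.span_induct_alt[OF assms(4), where h = "\<lambda>f. f \<in> QSym \<and> \<psi> f = c * \<phi> f"])
  have z: "0 \<in> QSym" unfolding QSym_def by (rule ser.span_zero)
  have "\<theta> 0 = 0" if "\<theta> \<in> QSym_dual" for \<theta> :: "'a functional"
  proof -
    have "\<theta> (sscale 0 0) = 0 * \<theta> 0" using that z unfolding QSym_dual_def by blast
    thus ?thesis by simp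
  qed
  from this[OF assms(1)] this[OF assms(2)] z show "0 \<in> QSym \<and> \<psi> 0 = c * \<phi> 0"
    by (metis mult_zero_right)
next
  fix d x y
  assume step: "x \<in> S" "y \<in> QSym \<and> \<psi> y = c * \<phi> y"
  have x: "x \<in> QSym" unfolding QSym_def using step(1) assms(3) by (blast intro: ser.span_base)
  have cx: "sscale d x \<in> QSym" using x unfolding QSym_def by (rule ser.span_scale)
  have sum: "sscale d x + y \<in> QSym"
    using cx step(2) unfolding QSym_def by (blast intro: ser.span_add)
  have lin: "\<theta> (sscale d x + y) = d * \<theta> x + \<theta> y" if "\<theta> \<in> QSym_dual" for \<theta> :: "'a functional"
  proof -
    have "\<theta> (sscale d x + y) = \<theta> (sscale d x) + \<theta> y" "\<theta> (sscale d x) = d * \<theta> x"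
      using that x cx step(2) unfolding QSym_dual_def by blast+
    thus ?thesis by simp
  qed
  have "\<psi> (sscale d x + y) = c * \<phi> (sscale d x + y)"
    unfolding lin[OF assms(1)] lin[OF assms(2)] using step(2) assms(5)[OF step(1)]
    by (simp add: algebra_simps)
  with sum show "sscale d x + y \<in> QSym \<and> \<psi> (sscale d x + y) = c * \<phi> (sscale d x + y)" by blast
qed

lemma QSym_dual_eqI:
  assumes "\<phi> \<in> QSym_dual" "\<psi> \<in> QSym_dual" "\<And>I. vcomp I \<Longrightarrow> \<phi> (MQ I) = \<psi> (MQ I)"
  shows "\<phi> = \<psi>"
proof
  fix f
  show "\<phi> f = \<psi> f"
  proof (cases "f \<in> QSym")
    case True
    hence "f \<in> QSym \<and> \<phi> f = 1 * \<psi> f"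
      unfolding QSym_def by (intro QSym_dual_span[OF assms(2,1) order_refl, unfolded QSym_def])
        (auto simp: assms(3))
    thus ?thesis by simp
  next
    case False
    thus ?thesis using assms(1,2) by (simp add: QSym_dual_def)
  qed
qed

lemma on_basis_ex1: "\<exists>!\<phi>. \<phi> \<in> QSym_dual \<and> (\<forall>I. vcomp I \<longrightarrow> \<phi> (MQ I) = g I)"
proof (rule ex_ex1I)
  interpret P: vector_space_pair "sscale :: rat \<Rightarrow> 'a series \<Rightarrow> 'a series" "(*) :: rat \<Rightarrow> rat \<Rightarrow> rat"
    by unfold_locales (auto simp: algebra_simps)
  let ?B = "{MQ I |I. vcomp I} :: 'a series set"
  obtain T where T: "Vector_Spaces.linear sscale (*) T"
    "\<forall>x\<in>?B. T x = g (inv_into {I. vcomp I} MQ x)"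
    using P.linear_independent_extend[OF independent_MQ, of "\<lambda>x. g (inv_into {I. vcomp I} MQ x)"]
    by blast
  interpret T: Vector_Spaces.linear sscale "(*)" T by fact
  define \<phi> where "\<phi> f = (if f \<in> QSym then T f else 0)" for f
  have "\<phi> \<in> QSym_dual"
    by (auto simp: QSym_dual_def \<phi>_def T.add T.scale QSym_def ser.span_add ser.span_scale)
  moreover have "\<phi> (MQ I) = g I" if "vcomp I" for I
  proof -
    have "MQ I \<in> QSym" using that by (auto simp: QSym_def intro: ser.span_base)
    moreover have "T (MQ I) = g (inv_into {I. vcomp I} MQ (MQ I))"
      using T(2) that by blast
    ultimately show ?thesis using that inv_into_f_f[OF inj_on_MQ, of I] by (simp add: \<phi>_def)
  qed
  ultimately show "\<exists>\<phi>. \<phi> \<in> QSym_dual \<and> (\<forall>I. vcomp I \<longrightarrow> \<phi> (MQ I) = g I)" by blast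
next
  fix \<phi> \<psi> :: "'a functional"
  assume "\<phi> \<in> QSym_dual \<and> (\<forall>I. vcomp I \<longrightarrow> \<phi> (MQ I) = g I)"
    "\<psi> \<in> QSym_dual \<and> (\<forall>I. vcomp I \<longrightarrow> \<psi> (MQ I) = g I)"
  thus "\<phi> = \<psi>" by (intro QSym_dual_eqI) auto
qed

lemma on_degrees_ex1:
  assumes "\<phi> \<in> QSym_dual"
  shows "\<exists>!\<psi>. \<psi> \<in> QSym_dual \<and> (\<forall>n. \<forall>h\<in>QSym_deg n. \<psi> h = c n * \<phi> h)"
proof (rule ex_ex1I)
  obtain \<psi> where \<psi>: "\<psi> \<in> QSym_dual" "\<And>I. vcomp I \<Longrightarrow> \<psi> (MQ I) = c (sum_list I) * \<phi> (MQ I)"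
    using on_basis_ex1[of "\<lambda>I. c (sum_list I) * \<phi> (MQ I)"] by blast
  have "\<psi> h = c n * \<phi> h" if "h \<in> QSym_deg n" for n h
    using QSym_dual_span[OF assms \<psi>(1) _ that[unfolded QSym_deg_def], of "c n"] \<psi>(2) by blast
  with \<psi>(1) show "\<exists>\<psi>. \<psi> \<in> QSym_dual \<and> (\<forall>n. \<forall>h\<in>QSym_deg n. \<psi> h = c n * \<phi> h)" by blast
next
  fix \<psi> \<psi>' :: "'a functional"
  assume a: "\<psi> \<in> QSym_dual \<and> (\<forall>n. \<forall>h\<in>QSym_deg n. \<psi> h = c n * \<phi> h)"
    "\<psi>' \<in> QSym_dual \<and> (\<forall>n. \<forall>h\<in>QSym_deg n. \<psi>' h = c n * \<phi> h)"
  have "MQ I \<in> QSym_deg (sum_list I)" if "vcomp I" for I :: "('a \<Rightarrow> nat) list"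
    using that by (auto simp: QSym_deg_def intro: ser.span_base)
  with a show "\<psi> = \<psi>'" by (intro QSym_dual_eqI) (blast, blast, metis)
qed

end

theory Submission
  imports Defs
begin

text \<open>
  From \<open>\<chi> = \<zeta>bar \<zeta>\<close> one gets \<open>\<zeta>bar - \<zeta>\<inverse> = (\<chi> - \<epsilon>) \<zeta>\<inverse>\<close> and \<open>\<chi> - \<epsilon> = (\<zeta>bar - \<zeta>\<inverse>) \<zeta>\<close>;
  comparing homogeneous components, either family of generators lies in the ideal of the other.
  For the last equality, the sign involution sends \<open>\<chi>\<close> to \<open>\<zeta> \<zeta>bar\<close>, and
  \<open>\<zeta> \<chi> = (\<zeta> \<zeta>bar) \<zeta>\<close>. In a degree \<open>n\<close> with \<open>|n|\<close> odd, the two extreme terms give \<open>2 \<chi>\<^sub>n\<close>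
  as a combination of products of the \<open>\<chi>\<^sub>b\<close> with \<open>0 < b < n\<close>, so induction applies.
\<close>

section \<open>Functionals by their values on the monomial basis\<close>

lemma vcomp_take [simp]: "vcomp I \<Longrightarrow> vcomp (take r I)"
  by (auto simp: vcomp_def dest: in_set_takeD)

lemma vcomp_drop [simp]: "vcomp I \<Longrightarrow> vcomp (drop r I)"
  by (auto simp: vcomp_def dest: in_set_dropD)

lemma vcomp_Nil [simp]: "vcomp []"
  by (simp add: vcomp_def)

text \<open>Natural-number entries cannot cancel, so the nonzero first entry of a nonempty
  composition survives in the sum. Hence degree 0 is spanned by \<open>MQ []\<close> alone.\<close>

lemma sum_list_vcomp_eq_0:
  fixes I :: "('l::finite \<Rightarrow> nat) list"
  assumes "vcomp I"
  shows "sum_list I = 0 \<longleftrightarrow> I = []"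
  using assms by (cases I) (auto simp: vcomp_def fun_eq_iff)

lemma on_basis:
  "on_basis g \<in> QSym_dual \<and> (\<forall>I. vcomp I \<longrightarrow> on_basis g (MQ I) = g I)"
  unfolding on_basis_def by (rule theI'[OF on_basis_ex1])

lemma on_basis_in_dual [simp]: "on_basis g \<in> QSym_dual"
  using on_basis by blast

lemma on_basis_MQ [simp]: "vcomp I \<Longrightarrow> on_basis g (MQ I) = g I"
  using on_basis by blast

lemma MQ_in_QSym_deg: "vcomp I \<Longrightarrow> MQ I \<in> QSym_deg (sum_list I)"
  by (auto simp: QSym_deg_def intro: ser.span_base)

text \<open>\<open>MQ I\<close> is homogeneous of degree \<open>sum_list I\<close>, so it sees only
  the factor \<open>c (sum_list I)\<close>. Both uses of \<open>on_degrees\<close> are of this form: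
  an indicator for \<open>deg_part\<close>, a sign for \<open>zetaQ_bar\<close>.\<close>

lemma on_degrees_scaling:
  assumes "\<phi> \<in> QSym_dual"
  shows "on_degrees (\<lambda>n h. c n * \<phi> h) = on_basis (\<lambda>I. c (sum_list I) * \<phi> (MQ I))"
proof -
  have *: "on_degrees (\<lambda>n h. c n * \<phi> h) \<in> QSym_dual \<and>
      (\<forall>n. \<forall>h\<in>QSym_deg n. on_degrees (\<lambda>n h. c n * \<phi> h) h = c n * \<phi> h)"
    unfolding on_degrees_def by (rule theI'[OF on_degrees_ex1[OF assms]])
  show ?thesis
    by (rule QSym_dual_eqI) (use * MQ_in_QSym_deg in auto)
qed

lemma deg_part_eq:
  assumes "\<phi> \<in> QSym_dual"
  shows "deg_part \<phi> n = on_basis (\<lambda>I. if sum_list I = n then \<phi> (MQ I) else 0)"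
proof -
  \<comment> \<open>Writing the case distinction as a 0/1 factor gives the shape
    \<open>c m * \<phi> h\<close>.\<close>
  have "deg_part \<phi> n = on_degrees (\<lambda>m h. of_bool (m = n) * \<phi> h)"
    unfolding deg_part_def by (rule arg_cong[where f = on_degrees]) (auto simp: fun_eq_iff)
  also have "\<dots> = on_basis (\<lambda>I. of_bool (sum_list I = n) * \<phi> (MQ I))"
    by (rule on_degrees_scaling[OF assms])
  also have "\<dots> = on_basis (\<lambda>I. if sum_list I = n then \<phi> (MQ I) else 0)"
    by (rule arg_cong[where f = on_basis]) (auto simp: fun_eq_iff)
  finally show ?thesis .
qed

lemma deg_part_MQ [simp]:
  "\<phi> \<in> QSym_dual \<Longrightarrow> vcomp I \<Longrightarrow> deg_part \<phi> n (MQ I) = (if sum_list I = n then \<phi> (MQ I) else 0)"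
  by (simp add: deg_part_eq)

lemma deg_part_in_dual [simp]: "\<phi> \<in> QSym_dual \<Longrightarrow> deg_part \<phi> n \<in> QSym_dual"
  by (simp add: deg_part_eq)

lemma conv_in_dual [simp]: "conv \<phi> \<psi> \<in> QSym_dual"
  by (simp add: conv_def)

lemma conv_MQ:
  "vcomp I \<Longrightarrow> conv \<phi> \<psi> (MQ I) = (\<Sum>r\<le>length I. \<phi> (MQ (take r I)) * \<psi> (MQ (drop r I)))"
  by (simp add: conv_def)

section \<open>Basis values of the counit and the characters, and linear operations on
  functionals\<close>

lemma counit_in_dual [simp]: "counit \<in> QSym_dual"
  by (simp add: counit_def)

lemma counit_MQ [simp]: "vcomp I \<Longrightarrow> counit (MQ I) = (if I = [] then 1 else 0)"
  by (simp add: counit_def)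

lemma zetaQ_in_dual [simp]: "zetaQ \<in> QSym_dual"
  by (simp add: zetaQ_def)

lemma zetaQ_MQ [simp]: "vcomp I \<Longrightarrow> zetaQ (MQ I) = (if length I \<le> 1 then 1 else 0)"
  by (simp add: zetaQ_def)

lemma zetaQ_bar_in_dual [simp]: "zetaQ_bar \<in> QSym_dual"
  by (simp add: zetaQ_bar_def on_degrees_scaling)

lemma zetaQ_bar_MQ:
  "vcomp I \<Longrightarrow> zetaQ_bar (MQ I) = (-1) ^ vsize (sum_list I) * zetaQ (MQ I)"
  by (simp add: zetaQ_bar_def on_degrees_scaling)

lemma euler_char_in_dual [simp]: "euler_char \<in> QSym_dual"
  by (simp add: euler_char_def)

lemma zero_in_dual [simp]: "0 \<in> QSym_dual"
  by (simp add: QSym_dual_def)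

lemma add_in_dual [simp]: "\<phi> \<in> QSym_dual \<Longrightarrow> \<psi> \<in> QSym_dual \<Longrightarrow> \<phi> + \<psi> \<in> QSym_dual"
  by (auto simp: QSym_dual_def algebra_simps)

lemma uminus_in_dual [simp]: "\<phi> \<in> QSym_dual \<Longrightarrow> - \<phi> \<in> QSym_dual"
  by (auto simp: QSym_dual_def algebra_simps)

lemma diff_in_dual [simp]: "\<phi> \<in> QSym_dual \<Longrightarrow> \<psi> \<in> QSym_dual \<Longrightarrow> \<phi> - \<psi> \<in> QSym_dual"
  by (auto simp: QSym_dual_def algebra_simps)

lemma sscale_apply: "sscale c f x = c * f x"
  by (simp add: sscale_def)

lemma sscale_in_dual [simp]: "\<phi> \<in> QSym_dual \<Longrightarrow> sscale c \<phi> \<in> QSym_dual"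
  by (auto simp: QSym_dual_def sscale_def algebra_simps)

lemma sum_in_dual: "(\<And>a. a \<in> A \<Longrightarrow> F a \<in> QSym_dual) \<Longrightarrow> sum F A \<in> QSym_dual"
  by (induction A rule: infinite_finite_induct) auto

lemma sum_functional_apply: "sum F A (x :: 'a) = (\<Sum>a\<in>A. F a x :: rat)"
  by (induction A rule: infinite_finite_induct) auto

section \<open>The convolution algebra\<close>

text \<open>Both sides sum over all ways to cut \<open>I\<close> into three consecutive pieces;
  \<open>T s r\<close> is the contribution of the cuts at \<open>s \<le> r\<close>.\<close>

lemma conv_assoc: "conv (conv \<phi> \<psi>) \<theta> = conv \<phi> (conv \<psi> \<theta>)"
proof (rule QSym_dual_eqI)
  fix I :: "('a \<Rightarrow> nat) list"
  assume I: "vcomp I"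
  define n where "n = length I"
  define T where "T s r = \<phi> (MQ (take s I)) * \<psi> (MQ (take (r - s) (drop s I))) * \<theta> (MQ (drop r I))"
    for s r
  have "conv (conv \<phi> \<psi>) \<theta> (MQ I) = (\<Sum>r\<le>n. \<Sum>s\<le>r. T s r)"
    using I by (auto simp: conv_MQ n_def T_def sum_distrib_right min_absorb2 min_absorb1 drop_take
        intro!: sum.cong)
  also have "\<dots> = (\<Sum>(r, s)\<in>(SIGMA r:{..n}. {..r}). T s r)"
    by (simp add: sum.Sigma)
  \<comment> \<open>The pair of cuts is now recorded by the first cut \<open>s\<close> and the
    length \<open>t\<close> of the middle piece.\<close>
  also have "\<dots> = (\<Sum>(s, t)\<in>(SIGMA s:{..n}. {..n - s}). T s (s + t))"
    by (rule sum.reindex_bij_witness[where i = "\<lambda>(s, t). (s + t, s)" and j = "\<lambda>(r, s). (s, r - s)"])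
      auto
  also have "\<dots> = (\<Sum>s\<le>n. \<Sum>t\<le>n - s. T s (s + t))"
    by (simp add: sum.Sigma)
  also have "\<dots> = conv \<phi> (conv \<psi> \<theta>) (MQ I)"
    using I by (auto simp: conv_MQ n_def T_def sum_distrib_left mult.assoc add.commute
        intro!: sum.cong)
  finally show "conv (conv \<phi> \<psi>) \<theta> (MQ I) = conv \<phi> (conv \<psi> \<theta>) (MQ I)" .
qed simp_all

lemma conv_counit_left [simp]:
  assumes "\<phi> \<in> QSym_dual"
  shows "conv counit \<phi> = \<phi>"
proof (rule QSym_dual_eqI)
  fix I :: "('a \<Rightarrow> nat) list"
  assume I: "vcomp I"
  have "conv counit \<phi> (MQ I) = (\<Sum>r\<le>length I. if r = 0 then \<phi> (MQ I) else 0)"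
    unfolding conv_MQ[OF I] using I by (intro sum.cong) auto
  thus "conv counit \<phi> (MQ I) = \<phi> (MQ I)" by simp
qed (use assms in simp_all)

lemma conv_counit_right [simp]:
  assumes "\<phi> \<in> QSym_dual"
  shows "conv \<phi> counit = \<phi>"
proof (rule QSym_dual_eqI)
  fix I :: "('a \<Rightarrow> nat) list"
  assume I: "vcomp I"
  have "conv \<phi> counit (MQ I) = (\<Sum>r\<le>length I. if r = length I then \<phi> (MQ I) else 0)"
    unfolding conv_MQ[OF I] using I by (intro sum.cong) auto
  thus "conv \<phi> counit (MQ I) = \<phi> (MQ I)" by simp
qed (use assms in simp_all)

lemma conv_add_left: "conv (\<phi> + \<psi>) \<theta> = conv \<phi> \<theta> + conv \<psi> \<theta>"
  by (rule QSym_dual_eqI) (simp_all add: conv_MQ algebra_simps sum.distrib)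

lemma conv_add_right: "conv \<theta> (\<phi> + \<psi>) = conv \<theta> \<phi> + conv \<theta> \<psi>"
  by (rule QSym_dual_eqI) (simp_all add: conv_MQ algebra_simps sum.distrib)

lemma conv_diff_left: "conv (\<phi> - \<psi>) \<theta> = conv \<phi> \<theta> - conv \<psi> \<theta>"
  by (rule QSym_dual_eqI) (simp_all add: conv_MQ algebra_simps sum_subtractf)

lemma conv_sscale_left: "conv (sscale c \<phi>) \<psi> = sscale c (conv \<phi> \<psi>)"
  by (rule QSym_dual_eqI) (simp_all add: conv_MQ sscale_apply mult.assoc sum_distrib_left)

text \<open>The full dual, not only the graded one, has to be a ring: \<open>zetaQ\<close> and its
  inverse have nonzero components in infinitely many degrees, and \<open>zetaQ_inv\<close> is an
  inverse taken here.\<close>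

lemma ring_Dual_alg: "ring (Dual_alg :: 'l::finite functional ring)"
proof (rule ringI)
  show "abelian_group (Dual_alg :: 'l functional ring)"
    by (rule abelian_groupI)
      (auto simp: Dual_alg_def add.assoc add.commute intro!: bexI[of _ "- _"])
  show "Group.monoid (Dual_alg :: 'l functional ring)"
    by (rule Group.monoidI) (auto simp: Dual_alg_def conv_assoc)
qed (auto simp: Dual_alg_def conv_add_left conv_add_right)

section \<open>The graded dual\<close>

text \<open>The degrees in which a functional is nonzero, tested on basis elements only, so that
  finiteness can be read off from the values at \<open>MQ I\<close>.\<close>

definition supp_deg :: "'l::finite functional \<Rightarrow> ('l \<Rightarrow> nat) set" where
  "supp_deg \<phi> = {sum_list I |I. vcomp I \<and> \<phi> (MQ I) \<noteq> 0}"

lemma supp_deg_eq: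
  assumes "\<phi> \<in> QSym_dual"
  shows "{n. \<exists>h\<in>QSym_deg n. \<phi> h \<noteq> 0} = supp_deg \<phi>"
proof -
  have "n \<in> supp_deg \<phi>" if h: "h \<in> QSym_deg n" "\<phi> h \<noteq> 0" for n h
  proof (rule ccontr)
    assume "n \<notin> supp_deg \<phi>"
    \<comment> \<open>With the constant 0, proportionality on the spanning set of a degree says that
      vanishing there extends to the span.\<close>
    hence "\<phi> h = 0 * \<phi> h"
      using QSym_dual_span[OF assms assms _ h(1)[unfolded QSym_deg_def], of 0]
      by (fastforce simp: supp_deg_def)
    with h(2) show False by simp
  qed
  moreover have "\<exists>h\<in>QSym_deg n. \<phi> h \<noteq> 0" if "n \<in> supp_deg \<phi>" for n
    using that MQ_in_QSym_deg by (auto simp: supp_deg_def)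
  ultimately show ?thesis by blast
qed

lemma carrier_NSym: "carrier NSym = {\<phi> \<in> QSym_dual. finite (supp_deg \<phi>)}"
  by (auto simp: NSym_def supp_deg_eq)

lemma NSym_ops [simp]:
  "mult NSym = conv" "one NSym = counit" "zero NSym = 0" "add NSym = (+)"
  by (simp_all add: NSym_def Dual_alg_def)

lemma supp_deg_0 [simp]: "supp_deg 0 = {}"
  by (simp add: supp_deg_def)

lemma supp_deg_counit: "supp_deg counit \<subseteq> {0}"
  by (auto simp: supp_deg_def split: if_splits)

lemma supp_deg_add: "supp_deg (\<phi> + \<psi>) \<subseteq> supp_deg \<phi> \<union> supp_deg \<psi>"
  by (auto simp: supp_deg_def)

lemma supp_deg_uminus [simp]: "supp_deg (- \<phi>) = supp_deg \<phi>"
  by (auto simp: supp_deg_def)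

lemma supp_deg_sscale: "supp_deg (sscale c \<phi>) \<subseteq> supp_deg \<phi>"
  by (auto simp: supp_deg_def sscale_def)

lemma supp_deg_deg_part: "\<phi> \<in> QSym_dual \<Longrightarrow> supp_deg (deg_part \<phi> n) \<subseteq> {n}"
  by (auto simp: supp_deg_def split: if_splits)

lemma sum_list_take_drop: "sum_list (take r I) + sum_list (drop r I) = (sum_list I :: 'a::monoid_add)"
  by (metis append_take_drop_id sum_list_append)

text \<open>A nonzero value at \<open>MQ I\<close> forces a nonzero summand at some cut, and the
  degrees of the two pieces add up to that of \<open>I\<close>. This makes the graded dual closed
  under convolution.\<close>

lemma supp_deg_conv: "supp_deg (conv \<phi> \<psi>) \<subseteq> (\<lambda>(a, b). a + b) ` (supp_deg \<phi> \<times> supp_deg \<psi>)"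
proof
  fix n
  assume "n \<in> supp_deg (conv \<phi> \<psi>)"
  then obtain I where I: "vcomp I" "n = sum_list I" "conv \<phi> \<psi> (MQ I) \<noteq> 0"
    by (auto simp: supp_deg_def)
  from I(3) obtain r where "\<phi> (MQ (take r I)) * \<psi> (MQ (drop r I)) \<noteq> 0"
    unfolding conv_MQ[OF I(1)] by (meson sum.neutral)
  hence "sum_list (take r I) \<in> supp_deg \<phi>" "sum_list (drop r I) \<in> supp_deg \<psi>"
    using I(1) by (auto simp: supp_deg_def)
  thus "n \<in> (\<lambda>(a, b). a + b) ` (supp_deg \<phi> \<times> supp_deg \<psi>)"
    using I(2) sum_list_take_drop[of r I]
    by (intro image_eqI[of _ _ "(sum_list (take r I), sum_list (drop r I))"]) auto
qed

lemma counit_in_NSym: "counit \<in> carrier NSym"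
  using supp_deg_counit by (auto simp: carrier_NSym intro: finite_subset)

lemma sscale_in_NSym: "\<phi> \<in> carrier NSym \<Longrightarrow> sscale c \<phi> \<in> carrier NSym"
  using supp_deg_sscale by (auto simp: carrier_NSym intro: finite_subset)

lemma deg_part_in_NSym: "\<phi> \<in> QSym_dual \<Longrightarrow> deg_part \<phi> n \<in> carrier NSym"
  using supp_deg_deg_part by (auto simp: carrier_NSym intro: finite_subset)

lemma add_in_NSym: "\<phi> \<in> carrier NSym \<Longrightarrow> \<psi> \<in> carrier NSym \<Longrightarrow> \<phi> + \<psi> \<in> carrier NSym"
  using finite_subset[OF supp_deg_add] by (auto simp: carrier_NSym)

lemma uminus_in_NSym: "\<phi> \<in> carrier NSym \<Longrightarrow> - \<phi> \<in> carrier NSym"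
  by (auto simp: carrier_NSym)

lemma conv_in_NSym: "\<phi> \<in> carrier NSym \<Longrightarrow> \<psi> \<in> carrier NSym \<Longrightarrow> conv \<phi> \<psi> \<in> carrier NSym"
  using finite_subset[OF supp_deg_conv] by (auto simp: carrier_NSym)

lemma ring_NSym: "ring (NSym :: 'l::finite functional ring)"
proof (rule ringI)
  show "abelian_group (NSym :: 'l functional ring)"
  proof (rule abelian_groupI)
    fix \<phi> :: "'l functional"
    assume "\<phi> \<in> carrier NSym"
    thus "\<exists>\<psi>\<in>carrier NSym. \<psi> \<oplus>\<^bsub>NSym\<^esub> \<phi> = \<zero>\<^bsub>NSym\<^esub>"
      by (intro bexI[of _ "- \<phi>"] uminus_in_NSym) auto
  qed (auto simp: add_in_NSym add.assoc add.commute, simp add: carrier_NSym)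
  show "Group.monoid (NSym :: 'l functional ring)"
    by (rule Group.monoidI) (auto simp: conv_in_NSym counit_in_NSym conv_assoc, auto simp: carrier_NSym)
qed (auto simp: conv_add_left conv_add_right)

section \<open>Two-sided ideals of the graded dual as rational subspaces\<close>

lemma ideal_NSym_0: "ideal J NSym \<Longrightarrow> 0 \<in> J"
  using additive_subgroup.zero_closed[OF ideal.axioms(1)] by fastforce

lemma ideal_NSym_add: "ideal J NSym \<Longrightarrow> \<phi> \<in> J \<Longrightarrow> \<psi> \<in> J \<Longrightarrow> \<phi> + \<psi> \<in> J"
  using additive_subgroup.a_closed[OF ideal.axioms(1)] by fastforce

lemma ideal_NSym_carrier: "ideal J NSym \<Longrightarrow> \<phi> \<in> J \<Longrightarrow> \<phi> \<in> carrier NSym"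
  using additive_subgroup.a_subset[OF ideal.axioms(1)] by blast

lemma ideal_NSym_conv_left:
  "ideal J NSym \<Longrightarrow> \<phi> \<in> J \<Longrightarrow> \<psi> \<in> carrier NSym \<Longrightarrow> conv \<psi> \<phi> \<in> J"
  using ideal.I_l_closed by fastforce

lemma ideal_NSym_conv_right:
  "ideal J NSym \<Longrightarrow> \<phi> \<in> J \<Longrightarrow> \<psi> \<in> carrier NSym \<Longrightarrow> conv \<phi> \<psi> \<in> J"
  using ideal.I_r_closed by fastforce

text \<open>Scaling by \<open>c\<close> is convolution with the ring element
  \<open>sscale c counit\<close>, so ring ideals are closed under it.\<close>

lemma ideal_NSym_sscale:
  assumes "ideal J NSym" "\<phi> \<in> J"
  shows "sscale c \<phi> \<in> J"
proof -
  have "\<phi> \<in> QSym_dual" using ideal_NSym_carrier[OF assms] by (simp add: carrier_NSym)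
  hence "sscale c \<phi> = conv (sscale c counit) \<phi>" by (simp add: conv_sscale_left)
  thus ?thesis using ideal_NSym_conv_left[OF assms sscale_in_NSym[OF counit_in_NSym]] by simp
qed

lemma ideal_NSym_diff:
  assumes "ideal J NSym" "\<phi> \<in> J" "\<psi> \<in> J"
  shows "\<phi> - \<psi> \<in> J"
proof -
  have "\<phi> - \<psi> = \<phi> + sscale (- 1) \<psi>" by (auto simp: sscale_def fun_eq_iff)
  thus ?thesis using ideal_NSym_add[OF assms(1,2) ideal_NSym_sscale[OF assms(1,3)]] by (simp only:)
qed

lemma ideal_NSym_sum: "ideal J NSym \<Longrightarrow> (\<And>a. a \<in> A \<Longrightarrow> F a \<in> J) \<Longrightarrow> sum F A \<in> J"
  by (induction A rule: infinite_finite_induct) (auto simp: ideal_NSym_0 ideal_NSym_add)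

section \<open>Homogeneous components\<close>

lemma finite_vectors_le: "finite {a :: 'l::finite \<Rightarrow> nat. a \<le> n}"
  by (rule finite_subset[OF _ finite_PiE[of UNIV "\<lambda>i. {..n i}"]]) (auto simp: le_fun_def)

lemma vsize_add: "vsize (a + b) = vsize a + vsize b"
  by (simp add: vsize_def sum.distrib)

text \<open>One coordinate drops and none rises. This makes \<open>vsize\<close> a measure for
  induction over degrees.\<close>

lemma vsize_strict_mono:
  assumes "a < n"
  shows "vsize a < vsize n"
proof -
  have "a \<le> n" "\<not> n \<le> a" using assms by (simp_all add: less_le_not_le)
  then obtain i where "a i < n i" "\<forall>j. a j \<le> n j"
    by (auto simp: le_fun_def not_le)
  thus ?thesis unfolding vsize_def by (intro sum_strict_mono_ex1) auto
qed

lemma deg_part_diff: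
  "\<phi> \<in> QSym_dual \<Longrightarrow> \<psi> \<in> QSym_dual \<Longrightarrow> deg_part (\<phi> - \<psi>) n = deg_part \<phi> n - deg_part \<psi> n"
  by (rule QSym_dual_eqI) auto

text \<open>At a basis element of degree \<open>n\<close>, each cut contributes to exactly one
  summand, the one where \<open>a\<close> is the degree of the left piece; in other degrees every
  summand vanishes.\<close>

lemma deg_part_conv:
  fixes \<phi> \<psi> :: "'l::finite functional"
  assumes "\<phi> \<in> QSym_dual" "\<psi> \<in> QSym_dual"
  shows "deg_part (conv \<phi> \<psi>) n = (\<Sum>a | a \<le> n. conv (deg_part \<phi> a) (deg_part \<psi> (n - a)))"
proof (rule QSym_dual_eqI)
  fix I :: "('l \<Rightarrow> nat) list"
  assume I: "vcomp I"
  \<comment> \<open>Subtraction is truncated in each coordinate, hence the condition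
    \<open>a \<le> n\<close>.\<close>
  have split: "b = n - a \<longleftrightarrow> a + b = n" if "a \<le> n" for a b :: "'l \<Rightarrow> nat"
  proof -
    have "b x = n x - a x \<longleftrightarrow> a x + b x = n x" for x
      using le_funD[OF that, of x] by auto
    thus ?thesis by (simp add: fun_eq_iff)
  qed
  have "(\<Sum>a | a \<le> n. conv (deg_part \<phi> a) (deg_part \<psi> (n - a))) (MQ I) =
      (\<Sum>a | a \<le> n. \<Sum>r\<le>length I. deg_part \<phi> a (MQ (take r I)) * deg_part \<psi> (n - a) (MQ (drop r I)))"
    using I by (simp add: sum_functional_apply conv_MQ)
  also have "\<dots> = (\<Sum>r\<le>length I. \<Sum>a | a \<le> n.
      deg_part \<phi> a (MQ (take r I)) * deg_part \<psi> (n - a) (MQ (drop r I)))"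
    by (rule sum.swap)
  also have "\<dots> = (\<Sum>r\<le>length I. if sum_list I = n then \<phi> (MQ (take r I)) * \<psi> (MQ (drop r I)) else 0)"
  proof (rule sum.cong[OF refl])
    fix r
    let ?t = "sum_list (take r I)" and ?d = "sum_list (drop r I)"
    let ?p = "\<phi> (MQ (take r I)) * \<psi> (MQ (drop r I))"
    \<comment> \<open>This puts the only contributing index \<open>a = ?t\<close> inside the range
      of summation when \<open>sum_list I = n\<close>.\<close>
    have le: "?t \<le> sum_list I"
      using sum_list_take_drop[of r I] by (metis le_fun_def le_add1 plus_fun_apply)
    have "(\<Sum>a | a \<le> n. deg_part \<phi> a (MQ (take r I)) * deg_part \<psi> (n - a) (MQ (drop r I)))
        = (\<Sum>a | a \<le> n. if a = ?t then (if sum_list I = n then ?p else 0) else 0)"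
    proof (rule sum.cong[OF refl])
      fix a
      assume "a \<in> {a. a \<le> n}"
      hence "?t = a \<and> ?d = n - a \<longleftrightarrow> a = ?t \<and> sum_list I = n"
        using split[of a ?d] sum_list_take_drop[of r I] by auto
      thus "deg_part \<phi> a (MQ (take r I)) * deg_part \<psi> (n - a) (MQ (drop r I)) =
          (if a = ?t then (if sum_list I = n then ?p else 0) else 0)"
        using I assms by auto
    qed
    also have "\<dots> = (if sum_list I = n then ?p else 0)"
      using le by (auto simp: finite_vectors_le)
    finally show "(\<Sum>a | a \<le> n. deg_part \<phi> a (MQ (take r I)) * deg_part \<psi> (n - a) (MQ (drop r I)))
        = (if sum_list I = n then ?p else 0)" .
  qed
  also have "\<dots> = deg_part (conv \<phi> \<psi>) n (MQ I)"
    using I by (simp add: conv_MQ)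
  finally show "deg_part (conv \<phi> \<psi>) n (MQ I) =
      (\<Sum>a | a \<le> n. conv (deg_part \<phi> a) (deg_part \<psi> (n - a))) (MQ I)" by simp
qed (auto intro: sum_in_dual)

text \<open>Only the left components must lie in \<open>J\<close>. The right factor enters through
  its components, which belong to \<open>NSym\<close> even when \<open>\<psi>\<close> itself does
  not, as for \<open>zetaQ\<close> and \<open>zetaQ_inv\<close>.\<close>

lemma deg_part_conv_in_ideal:
  assumes "ideal J NSym" "\<phi> \<in> QSym_dual" "\<psi> \<in> QSym_dual" "\<And>a. a \<le> n \<Longrightarrow> deg_part \<phi> a \<in> J"
  shows "deg_part (conv \<phi> \<psi>) n \<in> J"
  unfolding deg_part_conv[OF assms(2,3)]
  by (auto intro!: ideal_NSym_sum[OF assms(1)] ideal_NSym_conv_right[OF assms(1)]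
      assms(4) deg_part_in_NSym assms(3))

section \<open>The Euler character\<close>

text \<open>Write \<open>zetaQ\<close> as the counit plus the indicator of length one. The powers of
  that indicator are the indicators of each length, so the geometric series gives the inverse
  \<open>(-1) ^ length I\<close>.\<close>

lemma zetaQ_unit: "(zetaQ :: 'l::finite functional) \<in> Units Dual_alg"
proof -
  define \<eta> :: "'l functional" where "\<eta> = on_basis (\<lambda>I. (-1) ^ length I)"
  \<comment> \<open>Only \<open>r = 0\<close> and \<open>r = 1\<close> survive, and their signs
    cancel unless \<open>n = 0\<close>.\<close>
  have tail: "(\<Sum>r\<le>n. if r \<le> 1 then (-1) ^ (n - r) else 0) = (if n = 0 then 1 else 0 :: rat)" for n :: nat
  proof (cases n)
    case (Suc m)
    have "(\<Sum>r\<le>n. if r \<le> 1 then (-1) ^ (n - r) else 0 :: rat) = (\<Sum>r\<in>{0,1}. (-1) ^ (n - r))"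
      using Suc by (intro sum.mono_neutral_cong_right) auto
    thus ?thesis using Suc by simp
  qed simp
  have "conv zetaQ \<eta> = counit"
  proof (rule QSym_dual_eqI)
    fix I :: "('l \<Rightarrow> nat) list"
    assume I: "vcomp I"
    have "conv zetaQ \<eta> (MQ I) = (\<Sum>r\<le>length I. if r \<le> 1 then (-1) ^ (length I - r) else 0)"
      unfolding conv_MQ[OF I] using I by (intro sum.cong) (auto simp: \<eta>_def)
    thus "conv zetaQ \<eta> (MQ I) = counit (MQ I)"
      using I by (simp only: tail counit_MQ length_0_conv)
  qed simp_all
  moreover have "conv \<eta> zetaQ = counit"
  proof (rule QSym_dual_eqI)
    fix I :: "('l \<Rightarrow> nat) list"
    assume I: "vcomp I"
    have "conv \<eta> zetaQ (MQ I) = (\<Sum>r\<le>length I. if length I - r \<le> 1 then (-1) ^ r else 0)"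
      unfolding conv_MQ[OF I] using I by (intro sum.cong) (auto simp: \<eta>_def)
    \<comment> \<open>Counting the cut from the other end reduces this to the sum already
      evaluated.\<close>
    also have "\<dots> = (\<Sum>r\<le>length I. if r \<le> 1 then (-1) ^ (length I - r) else 0)"
      by (rule sum.reindex_bij_witness[where i = "\<lambda>r. length I - r" and j = "\<lambda>r. length I - r"]) auto
    finally show "conv \<eta> zetaQ (MQ I) = counit (MQ I)"
      using I by (simp only: tail counit_MQ length_0_conv)
  qed simp_all
  moreover have "\<eta> \<in> QSym_dual" by (simp add: \<eta>_def)
  ultimately show ?thesis by (auto simp: Units_def Dual_alg_def)
qed

lemma zetaQ_inv_in_dual [simp]: "zetaQ_inv \<in> QSym_dual"
  and conv_zetaQ_zetaQ_inv: "conv zetaQ zetaQ_inv = counit"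
  and conv_zetaQ_inv_zetaQ: "conv zetaQ_inv zetaQ = counit"
proof -
  interpret ring Dual_alg by (rule ring_Dual_alg)
  show "zetaQ_inv \<in> QSym_dual"
    using Units_inv_closed[OF zetaQ_unit] by (simp add: zetaQ_inv_def Dual_alg_def)
  show "conv zetaQ zetaQ_inv = counit"
    using Units_r_inv[OF zetaQ_unit] by (simp add: zetaQ_inv_def Dual_alg_def)
  show "conv zetaQ_inv zetaQ = counit"
    using Units_l_inv[OF zetaQ_unit] by (simp add: zetaQ_inv_def Dual_alg_def)
qed

lemma zetaQ_bar_diff_inv: "zetaQ_bar - zetaQ_inv = conv (euler_char - counit) zetaQ_inv"
  by (simp add: conv_diff_left euler_char_def conv_assoc conv_zetaQ_zetaQ_inv)

lemma euler_char_diff_counit: "euler_char - counit = conv (zetaQ_bar - zetaQ_inv) zetaQ"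
  by (simp add: conv_diff_left euler_char_def conv_zetaQ_inv_zetaQ)

section \<open>Degree zero and the sign symmetry of the Euler character\<close>

lemma deg_part_0_eq_counit:
  "\<phi> \<in> QSym_dual \<Longrightarrow> \<phi> (MQ []) = 1 \<Longrightarrow> deg_part \<phi> 0 = counit"
  by (rule QSym_dual_eqI) (auto simp: sum_list_vcomp_eq_0 simp del: sum_list_eq_0_iff)

lemma deg_part_zetaQ_0: "deg_part zetaQ 0 = counit"
  by (simp add: deg_part_0_eq_counit)

lemma deg_part_euler_char_0: "deg_part euler_char 0 = counit"
  by (rule deg_part_0_eq_counit) (simp_all add: euler_char_def conv_MQ zetaQ_bar_MQ vsize_def)

lemma deg_part_euler_char_diff_counit:
  "deg_part (euler_char - counit) n = (if n = 0 then 0 else deg_part euler_char n)"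
proof (cases "n = 0")
  case True
  have "deg_part counit 0 = (counit :: 'a functional)" by (simp add: deg_part_0_eq_counit)
  thus ?thesis using True by (simp add: deg_part_diff deg_part_euler_char_0)
next
  case False
  thus ?thesis by (intro QSym_dual_eqI) auto
qed

text \<open>At each cut the total sign is the product of the signs of the two pieces. Multiplying by
  it moves the sign from the left piece to the right one, since the left sign then occurs
  squared.\<close>

lemma deg_part_euler_char_reversed:
  "deg_part (conv zetaQ zetaQ_bar) n = sscale ((-1) ^ vsize n) (deg_part euler_char n)"
proof (rule QSym_dual_eqI)
  fix I :: "('a \<Rightarrow> nat) list"
  assume I: "vcomp I"
  have "conv zetaQ zetaQ_bar (MQ I) = (-1) ^ vsize (sum_list I) * euler_char (MQ I)"
    unfolding euler_char_def conv_MQ[OF I] sum_distrib_left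
  proof (rule sum.cong[OF refl])
    fix r
    show "zetaQ (MQ (take r I)) * zetaQ_bar (MQ (drop r I)) = (-1) ^ vsize (sum_list I) *
        (zetaQ_bar (MQ (take r I)) * zetaQ (MQ (drop r I)))"
      unfolding sum_list_take_drop[of r I, symmetric] vsize_add
      using I by (auto simp: zetaQ_bar_MQ power_add simp flip: power_mult_distrib)
  qed
  thus "deg_part (conv zetaQ zetaQ_bar) n (MQ I) =
      sscale ((-1) ^ vsize n) (deg_part euler_char n) (MQ I)"
    using I by (auto simp: sscale_def)
qed simp_all

text \<open>The degree \<open>n\<close> part of \<open>zetaQ\<close> times \<open>zetaQ_bar\<close>
  times \<open>zetaQ\<close> is expanded with either bracketing. Oddness makes the two occurrences
  of the top component differ in sign, so they do not cancel.\<close>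

lemma deg_part_euler_char_odd_in_ideal:
  fixes n :: "'l::finite \<Rightarrow> nat"
  assumes J: "ideal J NSym" and odd: "odd (vsize n)"
    and less: "\<And>a. 0 < a \<Longrightarrow> a < n \<Longrightarrow> deg_part euler_char a \<in> J"
  shows "deg_part euler_char n \<in> J"
proof -
  define \<chi> :: "('l \<Rightarrow> nat) \<Rightarrow> 'l functional" where "\<chi> = deg_part euler_char"
  define z :: "('l \<Rightarrow> nat) \<Rightarrow> 'l functional" where "z = deg_part zetaQ"
  \<comment> \<open>Both expansions are indexed by the degree \<open>a\<close> of the Euler factor,
    so that terms can be compared index by index; the sign in \<open>R\<close> comes from the
    reversed product.\<close>
  define L where "L a = conv (z (n - a)) (\<chi> a)" for a
  define R where "R a = sscale ((-1) ^ vsize a) (conv (\<chi> a) (z (n - a)))" for a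
  define A where "A = {a. 0 < a \<and> a < n}"
  have n: "n \<noteq> 0" using odd by (auto simp: vsize_def)
  have \<chi>: "\<chi> a \<in> QSym_dual" and z: "z a \<in> QSym_dual" "z a \<in> carrier NSym" for a
    by (auto simp: \<chi>_def z_def deg_part_in_NSym)
  \<comment> \<open>The two ends of the interval are distinct because \<open>n \<noteq> 0\<close>;
    \<open>A\<close> is its interior, where the hypothesis on smaller degrees applies.\<close>
  have split: "(\<Sum>a | a \<le> n. F a) = F 0 + (F n + sum F A)" for F :: "_ \<Rightarrow> 'l functional"
  proof -
    have "{a. a \<le> n} = insert 0 (insert n A)"
      by (auto simp: A_def order.strict_iff_order le_fun_def)
    moreover have "finite A"
      by (rule finite_subset[OF _ finite_vectors_le[of n]]) (auto simp: A_def)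
    ultimately show ?thesis using n by (simp add: A_def)
  qed
  have inv: "n - (n - a) = a" if "a \<le> n" for a
    using that by (simp add: le_fun_def fun_eq_iff)
  \<comment> \<open>\<open>deg_part_conv\<close> indexes by the degree of the left factor, here
    \<open>zetaQ\<close>; the reflection \<open>a\<close> to \<open>n - a\<close> passes to the
    Euler factor.\<close>
  have "(\<Sum>a | a \<le> n. L a) = (\<Sum>a | a \<le> n. conv (z a) (\<chi> (n - a)))"
    by (rule sum.reindex_bij_witness[where i = "\<lambda>a. n - a" and j = "\<lambda>a. n - a"])
      (auto simp: L_def inv, auto simp: le_fun_def)
  also have "\<dots> = deg_part (conv zetaQ euler_char) n"
    by (simp add: deg_part_conv z_def \<chi>_def)
  also have "conv zetaQ euler_char = conv (conv zetaQ zetaQ_bar) zetaQ"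
    by (simp add: euler_char_def conv_assoc)
  also have "deg_part \<dots> n = (\<Sum>a | a \<le> n. R a)"
    by (simp add: deg_part_conv R_def z_def \<chi>_def deg_part_euler_char_reversed conv_sscale_left)
  finally have "L 0 + (L n + sum L A) = R 0 + (R n + sum R A)"
    unfolding split .
  moreover have "L 0 = R 0"
    using z by (simp add: L_def R_def \<chi>_def deg_part_euler_char_0 vsize_def)
  moreover have "L n = \<chi> n"
    using \<chi> by (simp add: L_def z_def deg_part_zetaQ_0)
  moreover have "R n = - \<chi> n"
    using \<chi> odd by (simp add: R_def z_def deg_part_zetaQ_0 sscale_def fun_eq_iff)
  \<comment> \<open>The terms at 0 cancel and those at \<open>n\<close> combine to
    \<open>2 * \<chi> n\<close>, which is divided by 2 over the rationals.\<close>
  ultimately have "\<chi> n = sscale (1/2) (sum R A - sum L A)"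
    by (auto simp: sscale_def fun_eq_iff algebra_simps)
  moreover have "sum R A - sum L A \<in> J"
  proof (intro ideal_NSym_diff[OF J] ideal_NSym_sum[OF J])
    fix a
    assume "a \<in> A"
    hence "\<chi> a \<in> J" using less by (simp add: A_def \<chi>_def)
    thus "R a \<in> J" "L a \<in> J"
      unfolding R_def L_def using z(2)
      by (blast intro: ideal_NSym_sscale[OF J] ideal_NSym_conv_left[OF J] ideal_NSym_conv_right[OF J])+
  qed
  ultimately show ?thesis using ideal_NSym_sscale[OF J] by (simp add: \<chi>_def)
qed

section \<open>Equality of the three ideals\<close>

theorem theorem5p11:
  fixes k :: "'l::finite \<Rightarrow> enat"
  shows "IO_ideal k = Idl\<^bsub>NSym\<^esub> {deg_part euler_char n |n. 0 < n \<and> enat \<circ> n \<le> k}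
    \<and> Idl\<^bsub>NSym\<^esub> {deg_part euler_char n |n :: 'l \<Rightarrow> nat. 0 < n \<and> enat \<circ> n \<le> k}
      = Idl\<^bsub>NSym\<^esub> {deg_part euler_char n |n. 0 < n \<and> enat \<circ> n \<le> k \<and> even (vsize n)}"
proof -
  interpret N: ring "NSym :: 'l functional ring" by (rule ring_NSym)
  let ?G = "{deg_part zetaQ_bar n - deg_part zetaQ_inv n |n. enat \<circ> n \<le> k}"
  let ?X = "{deg_part euler_char n |n. 0 < n \<and> enat \<circ> n \<le> k}"
  let ?E = "{deg_part euler_char n |n. 0 < n \<and> enat \<circ> n \<le> k \<and> even (vsize n)}"
  \<comment> \<open>The index set is closed downwards, so every component in a degree
    \<open>a \<le> n\<close> occurring in a convolution is again available.\<close>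
  have down: "enat \<circ> a \<le> k" if "a \<le> n" "enat \<circ> n \<le> k" for a n :: "'l \<Rightarrow> nat"
    using that unfolding le_fun_def comp_apply by (meson enat_ord_simps(1) order_trans)
  have pos: "0 < n \<longleftrightarrow> n \<noteq> 0" for n :: "'l \<Rightarrow> nat"
    by (auto simp: order.strict_iff_order le_fun_def)
  have G: "?G \<subseteq> carrier NSym"
    by (auto simp flip: deg_part_diff intro: deg_part_in_NSym)
  have X: "?X \<subseteq> carrier NSym" and E: "?E \<subseteq> carrier NSym"
    by (auto intro: deg_part_in_NSym)
  note idG = N.genideal_ideal[OF G] and idX = N.genideal_ideal[OF X] and idE = N.genideal_ideal[OF E]
  have "?G \<subseteq> Idl\<^bsub>NSym\<^esub> ?X"
  proof clarify
    fix n :: "'l \<Rightarrow> nat"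
    assume n: "enat \<circ> n \<le> k"
    \<comment> \<open>Degree 0 contributes 0 and any other \<open>a \<le> n\<close> a
      generator.\<close>
    have "deg_part (euler_char - counit) a \<in> Idl\<^bsub>NSym\<^esub> ?X" if "a \<le> n" for a
      using down[OF that n] N.genideal_self[OF X] ideal_NSym_0[OF idX]
      by (auto simp: deg_part_euler_char_diff_counit pos)
    hence "deg_part (zetaQ_bar - zetaQ_inv) n \<in> Idl\<^bsub>NSym\<^esub> ?X"
      unfolding zetaQ_bar_diff_inv by (intro deg_part_conv_in_ideal[OF idX]) auto
    thus "deg_part zetaQ_bar n - deg_part zetaQ_inv n \<in> Idl\<^bsub>NSym\<^esub> ?X"
      by (simp add: deg_part_diff)
  qed
  moreover have "?X \<subseteq> Idl\<^bsub>NSym\<^esub> ?G"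
  proof clarify
    fix n :: "'l \<Rightarrow> nat"
    assume n: "0 < n" "enat \<circ> n \<le> k"
    have "deg_part (zetaQ_bar - zetaQ_inv) a \<in> Idl\<^bsub>NSym\<^esub> ?G" if "a \<le> n" for a
      using down[OF that n(2)] N.genideal_self[OF G] by (auto simp: deg_part_diff)
    hence "deg_part (euler_char - counit) n \<in> Idl\<^bsub>NSym\<^esub> ?G"
      unfolding euler_char_diff_counit by (intro deg_part_conv_in_ideal[OF idG]) auto
    thus "deg_part euler_char n \<in> Idl\<^bsub>NSym\<^esub> ?G"
      using n(1) by (simp add: deg_part_euler_char_diff_counit pos)
  qed
  ultimately have "IO_ideal k = Idl\<^bsub>NSym\<^esub> ?X"
    unfolding IO_ideal_def
    using N.genideal_minimal[OF idX, of ?G] N.genideal_minimal[OF idG, of ?X] by blast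
  \<comment> \<open>Strong induction on \<open>vsize n\<close>: even degrees are generators, and odd
    ones reduce to strictly smaller nonzero degrees of either parity.\<close>
  moreover have "deg_part euler_char n \<in> Idl\<^bsub>NSym\<^esub> ?E" if "0 < n" "enat \<circ> n \<le> k" for n :: "'l \<Rightarrow> nat"
    using that
  proof (induction "vsize n" arbitrary: n rule: less_induct)
    case less
    show ?case
    proof (cases "even (vsize n)")
      case True
      thus ?thesis using less.prems N.genideal_self[OF E] by auto
    next
      case False
      have "deg_part euler_char a \<in> Idl\<^bsub>NSym\<^esub> ?E" if a: "0 < a" "a < n" for a
        using less.hyps[OF vsize_strict_mono[OF a(2)] a(1)] down[OF less_imp_le[OF a(2)] less.prems(2)]
        by blast
      with False show ?thesis by (rule deg_part_euler_char_odd_in_ideal[OF idE])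
    qed
  qed
  moreover have "?E \<subseteq> Idl\<^bsub>NSym\<^esub> ?X" using N.genideal_self[OF X] by blast
  ultimately show ?thesis
    using N.genideal_minimal[OF idX, of ?E] N.genideal_minimal[OF idE, of ?X] by blast
qed

end
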